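(* Let $\mu\in\mathbb{R}$ be fixed. Then the asymmetric normal densities $\psi(\cdot\,;\mu,\sigma,p)$, with parameters $(\sigma,p)\in(0,\infty)\times(0,1)$, define an exponential family: for all $x\in\mathbb{R}$ and all $(\sigma,p)$, $$\psi(x;\mu,\sigma,p)=h(x)\exp\left(\eta(\sigma,p)^T T(x)-A(\sigma,p)\right),$$ with $$h(x)=\frac{1}{\sqrt{2\pi}},\qquad A(\sigma,p)=-\ln\beta,\qquad T(x)=\begin{bmatrix}(x-\mu)^2\,\mathbb{I}[x\ge\mu]\\ (x-\mu)^2\,\mathbb{I}[x<\mu]\end{bmatrix},\qquad \eta(\sigma,p)=\begin{bmatrix}-\dfrac{1}{2\sigma^2\alpha^{-2}}\\ -\dfrac{1}{2\sigma^2\alpha^{2}}\end{bmatrix}.$$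
   Context: For $p\in(0,1)$, $\sigma\in(0,\infty)$, $\mu\in\mathbb{R}$, with $\alpha=\sqrt{\frac{p}{1-p}}$ and $\beta=\frac{2\alpha}{\sigma(\alpha^2+1)}$, the asymmetric normal density is $$\psi(x;\mu,\sigma,p)=\begin{cases}\beta\,\Phi\left(\frac{x-\mu}{\sigma\alpha^{-1}}\right), & x\ge\mu,\\ \beta\,\Phi\left(\frac{x-\mu}{\sigma\alpha}\right), & x<\mu,\end{cases}$$ where $\Phi(\xi)=\frac{1}{\sqrt{2\pi}}\exp\left(-\frac12\xi^2\right)$ is the standard normal density. $\mathbb{I}[\cdot]$ is the indicator function. An exponential family is a set of densities of the form $f(x\mid\theta)=h(x)\exp(\eta(\theta)^T T(x)-A(\theta))$ for given functions $h,T,\eta,A$. *)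

theory Defs
  imports "HOL-Probability.Probability"
begin

definition asym_alpha :: "real \<Rightarrow> real" where
  "asym_alpha p = sqrt (p / (1 - p))"

definition asym_beta :: "real \<Rightarrow> real \<Rightarrow> real" where
  "asym_beta \<sigma> p = 2 * asym_alpha p / (\<sigma> * ((asym_alpha p)\<^sup>2 + 1))"

(* std_normal_density is the Phi of the usual notation: a density here, not the
   distribution function. *)
definition asym_normal_density :: "real \<Rightarrow> real \<Rightarrow> real \<Rightarrow> real \<Rightarrow> real" where
  "asym_normal_density \<mu> \<sigma> p x =
     (if x \<ge> \<mu>
      then asym_beta \<sigma> p * std_normal_density ((x - \<mu>) / (\<sigma> * inverse (asym_alpha p)))
      else asym_beta \<sigma> p * std_normal_density ((x - \<mu>) / (\<sigma> * asym_alpha p)))"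

definition is_prob_density :: "'a measure \<Rightarrow> ('a \<Rightarrow> real) \<Rightarrow> bool" where
  "is_prob_density M f \<longleftrightarrow>
     f \<in> borel_measurable M \<and> (\<forall>x\<in>space M. 0 \<le> f x) \<and> prob_space (density M (\<lambda>x. ennreal (f x)))"

(* The family f, indexed by the parameter set Theta, consists of densities with respect
   to M and has the exponential form given by h, eta, T and A, in that order. The form
   is required at every point of the space, not merely almost everywhere. *)
definition exponential_family ::
  "'a measure \<Rightarrow> 't set \<Rightarrow> ('t \<Rightarrow> 'a \<Rightarrow> real) \<Rightarrow>
   ('a \<Rightarrow> real) \<Rightarrow> ('t \<Rightarrow> real ^ 'k) \<Rightarrow> ('a \<Rightarrow> real ^ 'k) \<Rightarrow> ('t \<Rightarrow> real) \<Rightarrow> bool" where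
  "exponential_family M \<Theta> f h \<eta> T A \<longleftrightarrow>
     (\<forall>\<theta>\<in>\<Theta>. is_prob_density M (f \<theta>) \<and>
        (\<forall>x\<in>space M. f \<theta> x = h x * exp (\<eta> \<theta> \<bullet> T x - A \<theta>)))"

end

theory Submission
  imports Defs
begin

text \<open>
  Since \<open>\<beta> > 0\<close>, the factor \<open>\<beta>\<close> is absorbed into the exponent as \<open>ln \<beta>\<close>, and the two branches
  are selected by the two components of \<open>T\<close>. The densities have total mass one because each
  branch is a rescaled half of a standard normal density: the masses are \<open>\<beta>\<sigma> / (2\<alpha>)\<close> and
  \<open>\<beta>\<sigma>\<alpha> / 2\<close>, which add up to \<open>\<beta>\<sigma>(\<alpha>\<^sup>2 + 1) / (2\<alpha>) = 1\<close>.
\<close>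

text \<open>Substituting \<open>x / sqrt 2\<close> into the half-line Gaussian integral
  \<open>gaussian_moment_0\<close>, whose value is \<open>sqrt pi / 2\<close>, gives
  \<open>sqrt (pi / 2)\<close>; the normalising factor \<open>1 / sqrt (2 * pi)\<close> turns this
  into one half.\<close>

lemma has_bochner_integral_std_normal_half_right:
  "has_bochner_integral lborel (\<lambda>x. indicator {0..} x * std_normal_density x) (1 / 2)"
proof -
  have "has_bochner_integral lborel
      (\<lambda>x. indicator {0..} (0 + (1 / sqrt 2) * x) *\<^sub>R exp (- (0 + (1 / sqrt 2) * x)\<^sup>2))
      ((sqrt pi / 2) /\<^sub>R \<bar>1 / sqrt 2\<bar>)"
    using gaussian_moment_0
    by (subst lborel_has_bochner_integral_real_affine_iff [symmetric]) auto
  then have "has_bochner_integral lborel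
      (\<lambda>x. (1 / sqrt (2 * pi)) * (indicator {0..} (0 + (1 / sqrt 2) * x) *\<^sub>R exp (- (0 + (1 / sqrt 2) * x)\<^sup>2)))
      ((1 / sqrt (2 * pi)) * ((sqrt pi / 2) /\<^sub>R \<bar>1 / sqrt 2\<bar>))"
    by (rule has_bochner_integral_mult_right)
  moreover have "(1 / sqrt (2 * pi)) * ((sqrt pi / 2) /\<^sub>R \<bar>1 / sqrt 2\<bar>) = 1 / 2"
    by (simp add: real_sqrt_mult)
  moreover have "(\<lambda>x. (1 / sqrt (2 * pi)) * (indicator {0..} (0 + (1 / sqrt 2) * x) *\<^sub>R exp (- (0 + (1 / sqrt 2) * x)\<^sup>2)))
      = (\<lambda>x. indicator {0..} x * std_normal_density x)"
    by (auto simp: fun_eq_iff std_normal_density_def indicator_def power_divide zero_le_divide_iff)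
  ultimately show ?thesis by simp
qed

text \<open>Total mass one minus the right half. The half-line is open at 0 because the right half
  already contains that point.\<close>

lemma has_bochner_integral_std_normal_half_left:
  "has_bochner_integral lborel (\<lambda>x. indicator {..<0} x * std_normal_density x) (1 / 2)"
proof -
  have "has_bochner_integral lborel std_normal_density 1"
    using integrable_normal_density [of 1 0] integral_normal_density [of 1 0]
    by (simp add: has_bochner_integral_iff)
  from has_bochner_integral_diff [OF this has_bochner_integral_std_normal_half_right]
  have "has_bochner_integral lborel
      (\<lambda>x. std_normal_density x - indicator {0..} x * std_normal_density x) (1 / 2)"
    by simp
  moreover have "(\<lambda>x. std_normal_density x - indicator {0..} x * std_normal_density x)
      = (\<lambda>x. indicator {..<0} x * std_normal_density x)"
    by (auto simp: fun_eq_iff indicator_def)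
  ultimately show ?thesis by simp
qed

text \<open>Affine change of variables; the Jacobian \<open>\<bar>1 / c\<bar>\<close> is inverted to
  the factor \<open>c\<close>, as \<open>c\<close> is positive.\<close>

lemma has_bochner_integral_rescale:
  fixes f :: "real \<Rightarrow> real"
  assumes "has_bochner_integral lborel f I" and "c > 0"
  shows "has_bochner_integral lborel (\<lambda>x. f ((x - \<mu>) / c)) (c * I)"
proof -
  have "(\<lambda>x. f ((x - \<mu>) / c)) = (\<lambda>x. f (- \<mu> / c + (1 / c) * x))"
    by (simp add: diff_divide_distrib)
  moreover have "has_bochner_integral lborel (\<lambda>x. f (- \<mu> / c + (1 / c) * x)) (I /\<^sub>R \<bar>1 / c\<bar>)"
    using assms by (subst lborel_has_bochner_integral_real_affine_iff [symmetric]) auto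
  ultimately show ?thesis
    using assms(2) by simp
qed

lemma asym_alpha_pos: "p \<in> {0<..<1} \<Longrightarrow> 0 < asym_alpha p"
  by (simp add: asym_alpha_def)

lemma asym_beta_pos: "\<sigma> > 0 \<Longrightarrow> p \<in> {0<..<1} \<Longrightarrow> 0 < asym_beta \<sigma> p"
  using asym_alpha_pos [of p] by (simp add: asym_beta_def add_nonneg_pos)

lemma is_prob_density_asym_normal_density:
  assumes "\<sigma> > 0" and "p \<in> {0<..<1}"
  shows "is_prob_density lborel (asym_normal_density \<mu> \<sigma> p)"
proof -
  let ?f = "asym_normal_density \<mu> \<sigma> p"
  define a b where "a = asym_alpha p" and "b = asym_beta \<sigma> p"
  have a: "a > 0" and b: "b > 0"
    using assms asym_alpha_pos asym_beta_pos by (auto simp: a_def b_def)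
  \<comment> \<open>Both scales are positive, so the rescaled argument has the sign of
    \<open>x - \<mu>\<close>. The case distinction can therefore be moved into indicators of the
    rescaled argument, and each summand becomes a rescaled half normal density.\<close>
  have f_eq: "?f = (\<lambda>x.
      b * (indicator {0..} ((x - \<mu>) / (\<sigma> / a)) * std_normal_density ((x - \<mu>) / (\<sigma> / a))) +
      b * (indicator {..<0} ((x - \<mu>) / (\<sigma> * a)) * std_normal_density ((x - \<mu>) / (\<sigma> * a))))"
    using a assms(1)
    by (auto simp: fun_eq_iff asym_normal_density_def a_def b_def indicator_def field_simps)
  have "has_bochner_integral lborel ?f (b * (\<sigma> / a * (1 / 2)) + b * (\<sigma> * a * (1 / 2)))"
    unfolding f_eq using a assms(1)
    by (intro has_bochner_integral_add has_bochner_integral_mult_right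
        has_bochner_integral_rescale [OF has_bochner_integral_std_normal_half_right]
        has_bochner_integral_rescale [OF has_bochner_integral_std_normal_half_left]) auto
  moreover have "b * (\<sigma> / a * (1 / 2)) + b * (\<sigma> * a * (1 / 2)) = 1"
  proof -
    \<comment> \<open>This lets \<open>divide_simps\<close> clear the denominator of
      \<open>asym_beta\<close> without a case split.\<close>
    have "a\<^sup>2 + 1 \<noteq> 0"
      by (simp add: add_nonneg_eq_0_iff)
    then show ?thesis
      using a assms(1) unfolding b_def asym_beta_def a_def [symmetric]
      by (simp add: divide_simps) (simp add: algebra_simps power2_eq_square)
  qed
  ultimately have int: "has_bochner_integral lborel ?f 1"
    by simp
  have nonneg: "0 \<le> ?f x" for x
    using b by (simp add: asym_normal_density_def b_def)
  \<comment> \<open>Nonnegativity carries the Bochner integral over to the extended nonnegative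
    integral by which \<open>density\<close> measures the whole space.\<close>
  have "(\<integral>\<^sup>+x. ennreal (?f x) \<partial>lborel) = 1"
    using int nonneg by (simp add: nn_integral_eq_integral has_bochner_integral_iff)
  moreover have "?f \<in> borel_measurable lborel"
    using int by (blast dest: borel_measurable_has_bochner_integral)
  ultimately show ?thesis
    using nonneg by (auto simp: is_prob_density_def emeasure_density intro!: prob_spaceI)
qed

lemma asym_normal_density_exponential_form:
  assumes "\<sigma> > 0" and "p \<in> {0<..<1}"
  shows "asym_normal_density \<mu> \<sigma> p x = 1 / sqrt (2 * pi) *
    exp ((vector [- (1 / (2 * \<sigma>\<^sup>2 * asym_alpha p powi (-2))),
                  - (1 / (2 * \<sigma>\<^sup>2 * (asym_alpha p)\<^sup>2))] :: real ^ 2) \<bullet>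
         vector [(x - \<mu>)\<^sup>2 * indicator {x. x \<ge> \<mu>} x, (x - \<mu>)\<^sup>2 * indicator {x. x < \<mu>} x]
         - - ln (asym_beta \<sigma> p))"
proof -
  \<comment> \<open>The double minus comes from subtracting \<open>A = - ln \<beta>\<close>.\<close>
  have exp_ln: "exp (E - - ln (asym_beta \<sigma> p)) = asym_beta \<sigma> p * exp E" for E
    using asym_beta_pos [OF assms] by (simp add: exp_add)
  show ?thesis
    \<comment> \<open>At each \<open>x\<close> exactly one indicator is 1, so the inner product
      reduces to the exponent of the active branch.\<close>
    using assms(1) asym_alpha_pos [OF assms(2)] unfolding exp_ln
    by (simp add: inner_vec_def UNIV_2 asym_normal_density_def std_normal_density_def
        power_divide power_mult_distrib power_int_minus power_inverse)
qed

theorem corollary7: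
  fixes \<mu> :: real
  shows "exponential_family lborel ({0<..} \<times> {0<..<1})
    (\<lambda>(\<sigma>, p). asym_normal_density \<mu> \<sigma> p)
    (\<lambda>x. 1 / sqrt (2 * pi))
    (\<lambda>(\<sigma>, p). vector [- (1 / (2 * \<sigma>\<^sup>2 * asym_alpha p powi (-2))),
                      - (1 / (2 * \<sigma>\<^sup>2 * (asym_alpha p)\<^sup>2))] :: real ^ 2)
    (\<lambda>x. vector [(x - \<mu>)\<^sup>2 * indicator {x. x \<ge> \<mu>} x,
                 (x - \<mu>)\<^sup>2 * indicator {x. x < \<mu>} x])
    (\<lambda>(\<sigma>, p). - ln (asym_beta \<sigma> p))"
  unfolding exponential_family_def
  using is_prob_density_asym_normal_density asym_normal_density_exponential_form
  by auto

end
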